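(* Let $\mathbf{X}$ be a random array in $\mathbb{R}^{p_1\times\cdots\times p_u}$ and $Y$ a random variable. If $\mathbf{U}$ is a random matrix in $\mathbb{R}^{(p_1\cdots p_u)\times k}$ whose column space is contained in $\mathcal{S}_{Y|\mathrm{vec}(\mathbf{X})}$ almost surely, then $\mathcal{E}^{\otimes}_{p_1,\ldots,p_u}(\mathbf{U})$ is contained in $\mathcal{S}_{Y|\mathbf{X}^{\circ u}}$.
   Context: For $\mathbf{X}=\{X_{j_1\cdots j_u}:1\le j_i\le p_i\}$, $\mathrm{vec}(\mathbf{X})$ is the vector in $\mathbb{R}^{p_1\cdots p_u}$ of the elements of $\mathbf{X}$ listed with the first index changing fastest (and the last index slowest). $\perp\!\!\!\perp$ denotes (conditional) independence; $\mathrm{span}(\cdot)$ is column space; $\mathbf{P}_{\mathcal{S}}$ is the orthogonal projection onto $\mathcal{S}$; for subspaces, $\mathcal{S}\otimes\mathcal{S}'\otimes\cdots$ is the linear span of the corresponding Kronecker products of vectors. Conventional dimension reduction subspace: $\mathcal{S}_{Y|\mathrm{vec}(\mathbf{X})}$ is the intersection of all subspaces $\mathcal{S}\subseteq\mathbb{R}^{p_1\cdots p_u}$ with $Y\perp\!\!\!\perp\mathrm{vec}(\mathbf{X})\mid\mathbf{P}_{\mathcal{S}}\mathrm{vec}(\mathbf{X})$, assumed to satisfy this relation itself. Central dimension-folding subspace: $\mathcal{S}_{Y|\mathbf{X}^{\circ u}}$ is the smallest subspace of the form $\mathrm{span}(\boldsymbol{\alpha}^{(u)})\otimes\cdots\otimes\mathrm{span}(\boldsymbol{\alpha}^{(1)})$,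 with nonrandom matrices $\boldsymbol{\alpha}^{(i)}\in\mathbb{R}^{p_i\times d_i}$, for which $Y\perp\!\!\!\perp\mathbf{X}\mid(\boldsymbol{\alpha}^{(u)}\otimes\cdots\otimes\boldsymbol{\alpha}^{(1)})^T\mathrm{vec}(\mathbf{X})$. Such a smallest subspace is assumed to exist (and to satisfy this relation). Kronecker envelope: for a random matrix $\mathbf{U}\in\mathbb{R}^{(p_1\cdots p_u)\times k}$, there are subspaces $\mathcal{S}_1\subseteq\mathbb{R}^{p_1},\ldots,\mathcal{S}_u\subseteq\mathbb{R}^{p_u}$ such that (1) $\mathrm{span}(\mathbf{U})\subseteq\mathcal{S}_u\otimes\cdots\otimes\mathcal{S}_1$ almost surely, and (2) if $\mathcal{S}_1'\subseteq\mathbb{R}^{p_1},\ldots,\mathcal{S}_u'\subseteq\mathbb{R}^{p_u}$ also satisfy (1), then $\mathcal{S}_u\otimes\cdots\otimes\mathcal{S}_1\subseteq\mathcal{S}_u'\otimes\cdots\otimes\mathcal{S}_1'$. The uniquely determined subspace $\mathcal{S}_u\otimes\cdots\otimes\mathcal{S}_1$ is the Kronecker envelope of $\mathbf{U}$, written $\mathcal{E}^{\otimes}_{p_1,\ldots,p_u}(\mathbf{U})$. *)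

theory Defs
  imports "HOL-Probability.Probability" "Jordan_Normal_Form.VS_Connect"
begin

no_notation Finite_Cartesian_Product.vec.vec_nth (infixl "$" 90)
hide_type (open) Finite_Cartesian_Product.vec
hide_const (open) Finite_Cartesian_Product.vec

text \<open>
  The Borel sigma-algebras are transported along the coordinate maps, since the types of
  vectors and matrices of run-time dimension carry no topology.
\<close>

definition borel_vec :: "nat \<Rightarrow> real vec measure" where
  "borel_vec n = vimage_algebra (carrier_vec n) (\<lambda>v. \<lambda>i\<in>{..<n}. v $ i)
                   (\<Pi>\<^sub>M i\<in>{..<n}. borel)"

definition borel_mat :: "nat \<Rightarrow> nat \<Rightarrow> real mat measure" where
  "borel_mat n k = vimage_algebra (carrier_mat n k) (\<lambda>A. \<lambda>ij\<in>{..<n} \<times> {..<k}. A $$ ij)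
                     (\<Pi>\<^sub>M ij\<in>{..<n} \<times> {..<k}. borel)"

text \<open>
  A list \<open>ps = [p1, ..., pu]\<close> is the shape of an array; an array of that shape is an
  (extensional) function on the multi-indices \<open>[j1, ..., ju]\<close> with \<open>ji < pi\<close>.
  Indices start at \<open>0\<close>.
\<close>

definition borel_array :: "nat list \<Rightarrow> (nat list \<Rightarrow> real) measure" where
  "borel_array ps = (\<Pi>\<^sub>M js\<in>{js. list_all2 (<) js ps}. borel)"

text \<open>The multi-index at position \<open>k\<close> of the enumeration in which the first index changes fastest.\<close>

fun multi_index :: "nat list \<Rightarrow> nat \<Rightarrow> nat list" where
  "multi_index [] k = []"
| "multi_index (p # ps) k = (k mod p) # multi_index ps (k div p)"

definition vec_array :: "nat list \<Rightarrow> (nat list \<Rightarrow> real) \<Rightarrow> real vec" where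
  "vec_array ps x = vec (prod_list ps) (\<lambda>k. x (multi_index ps k))"

abbreviation vec_subspace :: "nat \<Rightarrow> real vec set \<Rightarrow> bool" where
  "vec_subspace n S \<equiv> VectorSpace.subspace class_ring S (module_vec TYPE(real) n)"

abbreviation vec_span :: "nat \<Rightarrow> real vec set \<Rightarrow> real vec set" where
  "vec_span n A \<equiv> LinearCombinations.module.span class_ring (module_vec TYPE(real) n) A"

abbreviation col_space :: "nat \<Rightarrow> real mat \<Rightarrow> real vec set" where
  "col_space n A \<equiv> vec_space.col_space n A"

definition orth_proj :: "real vec set \<Rightarrow> real vec \<Rightarrow> real vec" where
  "orth_proj S v = (THE w. w \<in> S \<and> (\<forall>s\<in>S. scalar_prod (v - w) s = 0))"

definition kron_vec :: "real vec \<Rightarrow> real vec \<Rightarrow> real vec" where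
  "kron_vec a b = vec (dim_vec a * dim_vec b)
                    (\<lambda>k. a $ (k div dim_vec b) * b $ (k mod dim_vec b))"

definition kron_mat :: "real mat \<Rightarrow> real mat \<Rightarrow> real mat" where
  "kron_mat A B = mat (dim_row A * dim_row B) (dim_col A * dim_col B)
     (\<lambda>(i, j). A $$ (i div dim_row B, j div dim_col B) * B $$ (i mod dim_row B, j mod dim_col B))"

text \<open>
  Lists are indexed by the mode, while the Kronecker factors appear in reverse order:
  \<open>[v1, ..., vu]\<close> is sent to the product of \<open>vu, ..., v1\<close>.
\<close>

fun kron_vecs :: "real vec list \<Rightarrow> real vec" where
  "kron_vecs [] = vec 1 (\<lambda>_. 1)"
| "kron_vecs (v # vs) = kron_vec (kron_vecs vs) v"

text \<open>The reversal matches \<open>vec_array\<close>: a rank-one array is sent to the product of its factors.\<close>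

lemma kron_vecs_eq_vec_array:
  "kron_vecs vs = vec_array (map dim_vec vs) (\<lambda>js. prod_list (map2 vec_index vs js))"
proof (induction vs)
  case (Cons v vs)
  have "dim_vec (kron_vecs vs) = prod_list (map dim_vec vs)"
    using Cons.IH by (simp add: vec_array_def)
  moreover have "kron_vecs vs $ (k div dim_vec v)
      = prod_list (map2 vec_index vs (multi_index (map dim_vec vs) (k div dim_vec v)))"
    if "k < prod_list (map dim_vec vs) * dim_vec v" for k
    using that Cons.IH by (simp add: vec_array_def less_mult_imp_div_less)
  ultimately show ?case
    by (auto simp: kron_vec_def vec_array_def mult.commute)
qed (auto simp: vec_array_def)

fun kron_mats :: "real mat list \<Rightarrow> real mat" where
  "kron_mats [] = 1\<^sub>m 1"
| "kron_mats (A # As) = kron_mat (kron_mats As) A"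

definition kron_space :: "nat list \<Rightarrow> real vec set list \<Rightarrow> real vec set" where
  "kron_space ps Ss = vec_span (prod_list ps) {kron_vecs vs | vs. list_all2 (\<in>) vs Ss}"

text \<open>
  \<open>Y\<close> and \<open>X\<close> are conditionally independent given the sigma-algebra generated by \<open>Z\<close>.
  The measures \<open>N\<^sub>Y\<close>, \<open>N\<^sub>X\<close>, \<open>N\<^sub>Z\<close> only serve as measurable spaces.
\<close>

definition cond_indep_var ::
  "'w measure \<Rightarrow> 'b measure \<Rightarrow> ('w \<Rightarrow> 'b) \<Rightarrow> 'c measure \<Rightarrow> ('w \<Rightarrow> 'c) \<Rightarrow> 'd measure \<Rightarrow> ('w \<Rightarrow> 'd) \<Rightarrow> bool"
where
  "cond_indep_var M N\<^sub>Y Y N\<^sub>X X N\<^sub>Z Z \<longleftrightarrow>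
     Y \<in> measurable M N\<^sub>Y \<and> X \<in> measurable M N\<^sub>X \<and> Z \<in> measurable M N\<^sub>Z \<and>
     (let F = vimage_algebra (space M) Z N\<^sub>Z;
          P = (\<lambda>E. real_cond_exp M F (indicator E))
      in \<forall>A\<in>sets N\<^sub>Y. \<forall>B\<in>sets N\<^sub>X.
           AE \<omega> in M. P ((Y -` A \<inter> space M) \<inter> (X -` B \<inter> space M)) \<omega> =
                      P (Y -` A \<inter> space M) \<omega> * P (X -` B \<inter> space M) \<omega>)"

definition dr_subspace ::
  "'w measure \<Rightarrow> ('w \<Rightarrow> real) \<Rightarrow> nat \<Rightarrow> ('w \<Rightarrow> real vec) \<Rightarrow> real vec set \<Rightarrow> bool" where
  "dr_subspace M Y n Z S \<longleftrightarrow>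
     vec_subspace n S \<and>
     cond_indep_var M borel Y (borel_vec n) Z (borel_vec n) (\<lambda>\<omega>. orth_proj S (Z \<omega>))"

definition central_subspace ::
  "'w measure \<Rightarrow> ('w \<Rightarrow> real) \<Rightarrow> nat \<Rightarrow> ('w \<Rightarrow> real vec) \<Rightarrow> real vec set" where
  "central_subspace M Y n Z = \<Inter>{S. dr_subspace M Y n Z S}"

definition folding_subspace ::
  "'w measure \<Rightarrow> ('w \<Rightarrow> real) \<Rightarrow> nat list \<Rightarrow> ('w \<Rightarrow> nat list \<Rightarrow> real) \<Rightarrow> real vec set \<Rightarrow> bool" where
  "folding_subspace M Y ps X T \<longleftrightarrow>
     (\<exists>\<alpha>s. list_all2 (\<lambda>p \<alpha>. dim_row \<alpha> = p) ps \<alpha>s \<and>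
           T = kron_space ps (map2 col_space ps \<alpha>s) \<and>
           cond_indep_var M borel Y (borel_array ps) X (borel_vec (dim_col (kron_mats \<alpha>s)))
             (\<lambda>\<omega>. (kron_mats \<alpha>s)\<^sup>T *\<^sub>v vec_array ps (X \<omega>)))"

definition central_folding_subspace ::
  "'w measure \<Rightarrow> ('w \<Rightarrow> real) \<Rightarrow> nat list \<Rightarrow> ('w \<Rightarrow> nat list \<Rightarrow> real) \<Rightarrow> real vec set" where
  "central_folding_subspace M Y ps X = (LEAST T. folding_subspace M Y ps X T)"

definition kron_envelope :: "'w measure \<Rightarrow> nat list \<Rightarrow> ('w \<Rightarrow> real mat) \<Rightarrow> real vec set" where
  "kron_envelope M ps U =
     (LEAST K. \<exists>Ss. list_all2 vec_subspace ps Ss \<and> K = kron_space ps Ss \<and>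
                    (AE \<omega> in M. col_space (prod_list ps) (U \<omega>) \<subseteq> K))"

end

theory Submission
  imports Defs
begin

text \<open>
  Let \<open>T\<close> be the central dimension-folding subspace and \<open>A\<close> the Kronecker product of the matrices
  that realise it, so that \<open>T\<close> is the column space of \<open>A\<close>
  (\<open>col_space_kron_mats\<close>).  Two facts carry the result.

  First, conditioning on \<open>A\<^sup>T v\<close> is the same as conditioning on the projection of \<open>v\<close> onto \<open>T\<close>:
  each is a linear, hence measurable, function of the other, so both generate the same
  \<open>\<sigma>\<close>-algebra.  Consequently \<open>T\<close> is an ordinary dimension reduction subspace
  (\<open>folding_subspace_imp_dr_subspace\<close>) and contains the central subspace, and with it almost
  surely the columns of \<open>U\<close>.

  Secondly, \<open>T\<close> is itself a Kronecker product of subspaces, so it is one of the candidates among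
  which the envelope is the least.  This settles the inclusion once the least candidate is known
  to exist, for otherwise the envelope would be an arbitrary set.  Candidates are closed under
  intersection because factorwise intersection commutes with the Kronecker product
  (\<open>kron_space_Int\<close>): a vector belongs to a Kronecker product of subspaces exactly when, viewed as
  an array, all its fibres in each direction belong to the corresponding factor
  (\<open>kron_space_Cons\<close>).  An almost sure inclusion survives only countable intersections, and
  finite dimension reduces the search for the least candidate to binary ones
  (\<open>least_of_inter_closed_subspaces\<close>).

  Both parts use orthogonal bases.  They give an explicit formula for the projection, from which
  measurability is read off, and they split a vector with fibres in prescribed subspaces into
  Kronecker products.
\<close>

section \<open>Subspaces, orthogonal systems and orthogonal projections\<close>

lemma vec_subspace_iff:
  "vec_subspace n S \<longleftrightarrow>
     S \<subseteq> carrier_vec n \<and> 0\<^sub>v n \<in> S \<and> (\<forall>a\<in>S. \<forall>b\<in>S. a + b \<in> S) \<and> (\<forall>c. \<forall>a\<in>S. c \<cdot>\<^sub>v a \<in> S)"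
  unfolding subspace_def submodule_def using vec_vs vec_module
  by (auto simp: module_vec_simps class_ring_simps)

lemma vec_subspace_span: "A \<subseteq> carrier_vec n \<Longrightarrow> vec_subspace n (vec_span n A)"
  unfolding subspace_def using vec_vs module.span_is_submodule[OF vec_module]
  by (auto simp: module_vec_simps)

lemma vec_span_superset: "A \<subseteq> carrier_vec n \<Longrightarrow> A \<subseteq> vec_span n A"
  using module.in_own_span[OF vec_module] by (auto simp: module_vec_simps)

lemma vec_span_least: "A \<subseteq> S \<Longrightarrow> vec_subspace n S \<Longrightarrow> vec_span n A \<subseteq> S"
  unfolding subspace_def by (intro module.span_is_subset[OF vec_module]) auto

lemma vec_subspace_diff:
  assumes "vec_subspace n S" "v \<in> S" "w \<in> S"
  shows "v - w \<in> S"
proof -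
  have "v - w = v + (-1) \<cdot>\<^sub>v w"
    using assms by (auto simp: vec_subspace_iff intro!: eq_vecI)
  then show ?thesis
    using assms by (simp add: vec_subspace_iff)
qed

text \<open>
  Vectors of all dimensions share one type, so there is no common zero vector to serve as an empty
  sum; linear combinations are therefore formed coordinatewise.
\<close>
lemma vec_subspace_sum:
  assumes S: "vec_subspace n S" and f: "\<And>b. b \<in> B \<Longrightarrow> f b \<in> S"
  shows "vec n (\<lambda>i. \<Sum>b\<in>B. c b * f b $ i) \<in> S"
  using f
proof (induction B rule: infinite_finite_induct)
  case (insert b B)
  have "f b \<in> carrier_vec n"
    using insert.prems S by (auto simp: vec_subspace_iff)
  then have "vec n (\<lambda>i. \<Sum>b\<in>insert b B. c b * f b $ i)
      = c b \<cdot>\<^sub>v f b + vec n (\<lambda>i. \<Sum>b\<in>B. c b * f b $ i)"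
    using insert.hyps by (auto intro!: eq_vecI)
  then show ?case
    using insert S by (simp add: vec_subspace_iff)
qed (use S in \<open>auto simp: vec_subspace_iff zero_vec_def\<close>)

lemma scalar_prod_self_eq_0_iff:
  fixes v :: "real vec"
  assumes "v \<in> carrier_vec n"
  shows "scalar_prod v v = 0 \<longleftrightarrow> v = 0\<^sub>v n"
proof -
  have "scalar_prod v v = (\<Sum>i<n. (v $ i)\<^sup>2)"
    using assms by (auto simp: scalar_prod_def power2_eq_square atLeast0LessThan)
  then show ?thesis
    using assms by (auto simp: sum_nonneg_eq_0_iff intro!: eq_vecI)
qed

definition orthogonal_system :: "nat \<Rightarrow> real vec set \<Rightarrow> bool" where
  "orthogonal_system n B \<longleftrightarrow>
     finite B \<and> B \<subseteq> carrier_vec n \<and> 0\<^sub>v n \<notin> B \<and> pairwise (\<lambda>b c. scalar_prod b c = 0) B"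

lemma orthogonal_system_insert:
  assumes B: "orthogonal_system n B" and r: "r \<in> carrier_vec n" "r \<noteq> 0\<^sub>v n"
    and orth: "\<And>b. b \<in> B \<Longrightarrow> scalar_prod r b = 0"
  shows "orthogonal_system n (insert r B)" and "r \<notin> B"
proof -
  show "orthogonal_system n (insert r B)"
    using assms comm_scalar_prod[of _ n r]
    by (auto simp: orthogonal_system_def pairwise_insert subset_iff)
  show "r \<notin> B"
    using orth[of r] r scalar_prod_self_eq_0_iff by blast
qed

text \<open>
  An orthogonal system of nonzero vectors is linearly independent.  This bound is the only form in
  which finite dimension enters below: every maximality argument maximises the size of such a system.
\<close>
lemma card_orthogonal_system_le:
  assumes "orthogonal_system n B"
  shows "card B \<le> n"
proof -
  interpret vec_space "TYPE(real)" n .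
  from assms have fin: "finite B" and B: "B \<subseteq> carrier_vec n" and nz: "0\<^sub>v n \<notin> B"
    and orth: "pairwise (\<lambda>b c. scalar_prod b c = 0) B"
    by (auto simp: orthogonal_system_def)
  have "lin_indpt B"
  proof (rule finite_lin_indpt2)
    fix a assume a: "lincomb a B = 0\<^sub>v n"
    have "a b = 0" if "b \<in> B" for b
    proof -
      have b: "b \<in> carrier_vec n" using that B by auto
      have "0 = scalar_prod (lincomb a B) b"
        using a b by (simp add: module_vec_simps)
      also have "\<dots> = (\<Sum>c\<in>B. a c * scalar_prod c b)"
        unfolding lincomb_def using B b
        by (subst finsum_scalar_prod_sum) (auto simp: module_vec_simps intro!: sum.cong)
      also have "\<dots> = (\<Sum>c\<in>B. if c = b then a b * scalar_prod b b else 0)"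
        using orth that by (intro sum.cong) (auto simp: pairwise_def)
      also have "\<dots> = a b * scalar_prod b b"
        using fin that by simp
      finally show ?thesis
        using scalar_prod_self_eq_0_iff[OF b] that nz by auto
    qed
    then show "\<forall>v\<in>B. a v = 0" by simp
  qed (use fin B in auto)
  then show ?thesis
    using li_le_dim(2)[of B] fin B dim_is_n by auto
qed

text \<open>
  The Fourier expansion of \<open>v\<close> along \<open>B\<close>.  Writing it coordinatewise makes it a visibly measurable
  function of the coefficients.
\<close>
definition orth_expansion :: "nat \<Rightarrow> real vec set \<Rightarrow> real vec \<Rightarrow> real vec" where
  "orth_expansion n B v = vec n (\<lambda>i. \<Sum>b\<in>B. scalar_prod v b / scalar_prod b b * b $ i)"

lemma orth_expansion_carrier [simp]: "orth_expansion n B v \<in> carrier_vec n"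
  by (simp add: orth_expansion_def)

lemma dim_orth_expansion [simp]: "dim_vec (orth_expansion n B v) = n"
  by (simp add: orth_expansion_def)

lemma orth_expansion_in_subspace:
  "vec_subspace n S \<Longrightarrow> B \<subseteq> S \<Longrightarrow> orth_expansion n B v \<in> S"
  unfolding orth_expansion_def by (rule vec_subspace_sum) auto

lemma scalar_prod_orth_expansion:
  assumes "B \<subseteq> carrier_vec n" "u \<in> carrier_vec n"
  shows "scalar_prod (orth_expansion n B v) u
       = (\<Sum>b\<in>B. scalar_prod v b / scalar_prod b b * scalar_prod b u)"
proof -
  have "scalar_prod (orth_expansion n B v) u
      = (\<Sum>i<n. \<Sum>b\<in>B. scalar_prod v b / scalar_prod b b * b $ i * u $ i)"
    using assms
    by (simp add: scalar_prod_def orth_expansion_def atLeast0LessThan sum_distrib_right)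
  also have "\<dots> = (\<Sum>b\<in>B. \<Sum>i<n. scalar_prod v b / scalar_prod b b * b $ i * u $ i)"
    by (rule sum.swap)
  also have "\<dots> = (\<Sum>b\<in>B. scalar_prod v b / scalar_prod b b * scalar_prod b u)"
    using assms(2)
    by (auto simp: scalar_prod_def atLeast0LessThan sum_distrib_left mult.assoc intro!: sum.cong)
  finally show ?thesis .
qed

lemma orth_expansion_residual:
  assumes B: "orthogonal_system n B" and "b \<in> B" "v \<in> carrier_vec n"
  shows "scalar_prod (v - orth_expansion n B v) b = 0"
proof -
  have b: "b \<in> carrier_vec n" and fin: "finite B"
    using assms by (auto simp: orthogonal_system_def)
  have nz: "scalar_prod b b \<noteq> 0"
    using assms scalar_prod_self_eq_0_iff[OF b] by (auto simp: orthogonal_system_def)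
  have "scalar_prod (orth_expansion n B v) b
      = (\<Sum>c\<in>B. scalar_prod v c / scalar_prod c c * scalar_prod c b)"
    using B b by (intro scalar_prod_orth_expansion) (auto simp: orthogonal_system_def)
  also have "\<dots> = (\<Sum>c\<in>B. if c = b then scalar_prod v b else 0)"
    using assms nz by (intro sum.cong) (auto simp: orthogonal_system_def pairwise_def)
  also have "\<dots> = scalar_prod v b"
    using fin \<open>b \<in> B\<close> by simp
  finally show ?thesis
    using b assms(3) by (simp add: minus_scalar_prod_distrib[of _ n])
qed

definition orthogonal_basis :: "nat \<Rightarrow> real vec set \<Rightarrow> real vec set \<Rightarrow> bool" where
  "orthogonal_basis n S B \<longleftrightarrow>
     orthogonal_system n B \<and> B \<subseteq> S \<and> (\<forall>s\<in>S. orth_expansion n B s = s)"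

text \<open>
  An orthogonal system in \<open>S\<close> of maximal size works: if some \<open>s\<close> in \<open>S\<close> differed from its
  expansion, the difference would be a nonzero vector of \<open>S\<close> orthogonal to the system and would
  enlarge it.
\<close>
lemma orthogonal_basis_exists:
  assumes S: "vec_subspace n S"
  obtains B where "orthogonal_basis n S B"
proof -
  define P where "P m \<longleftrightarrow> (\<exists>B. orthogonal_system n B \<and> B \<subseteq> S \<and> card B = m)" for m
  have "P 0"
    by (auto simp: P_def orthogonal_system_def intro!: exI[of _ "{}"])
  moreover have bound: "\<forall>m. P m \<longrightarrow> m \<le> n"
    using card_orthogonal_system_le by (auto simp: P_def)
  ultimately have "P (Greatest P)"
    by (metis GreatestI_nat)
  then obtain B where B: "orthogonal_system n B" "B \<subseteq> S" "card B = Greatest P"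
    by (auto simp: P_def)
  have "orth_expansion n B s = s" if s: "s \<in> S" for s
  proof (rule ccontr)
    define r where "r = s - orth_expansion n B s"
    assume neq: "orth_expansion n B s \<noteq> s"
    have sc: "s \<in> carrier_vec n" using S s by (auto simp: vec_subspace_iff)
    have rS: "r \<in> S"
      unfolding r_def using S s orth_expansion_in_subspace[OF S B(2)]
      by (intro vec_subspace_diff)
    have rc: "r \<in> carrier_vec n" using S rS by (auto simp: vec_subspace_iff)
    have "r \<noteq> 0\<^sub>v n"
    proof
      assume "r = 0\<^sub>v n"
      then have "orth_expansion n B s + r = orth_expansion n B s"
        by simp
      moreover have "orth_expansion n B s + r = s"
        using sc unfolding r_def by (intro eq_vecI) auto
      ultimately show False using neq by simp
    qed
    from orthogonal_system_insert[OF B(1) rc this] 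
    have "orthogonal_system n (insert r B)" "r \<notin> B"
      using orth_expansion_residual[OF B(1) _ sc] by (auto simp: r_def)
    then have "P (Suc (card B))"
      using B rS by (auto simp: P_def orthogonal_system_def intro!: exI[of _ "insert r B"])
    then show False
      using Greatest_le_nat[of P "Suc (card B)" n] bound B(3) by auto
  qed
  then show ?thesis
    using B that by (auto simp: orthogonal_basis_def)
qed

lemma orthogonal_basis_residual:
  assumes S: "vec_subspace n S" and B: "orthogonal_basis n S B"
    and v: "v \<in> carrier_vec n" and s: "s \<in> S"
  shows "scalar_prod (v - orth_expansion n B v) s = 0"
proof -
  let ?r = "v - orth_expansion n B v"
  have sys: "orthogonal_system n B" and s_eq: "orth_expansion n B s = s"
    using B s by (auto simp: orthogonal_basis_def)
  have sc: "s \<in> carrier_vec n" using S s by (auto simp: vec_subspace_iff)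
  have r: "?r \<in> carrier_vec n" using v by simp
  have "scalar_prod ?r s = scalar_prod (orth_expansion n B s) ?r"
    using r sc s_eq by (simp add: comm_scalar_prod[of _ n])
  also have "\<dots> = (\<Sum>b\<in>B. scalar_prod s b / scalar_prod b b * scalar_prod b ?r)"
    using sys r by (intro scalar_prod_orth_expansion) (auto simp: orthogonal_system_def)
  also have "\<dots> = 0"
  proof (rule sum.neutral, rule ballI)
    fix b assume b: "b \<in> B"
    then have "b \<in> carrier_vec n" using sys by (auto simp: orthogonal_system_def)
    then have "scalar_prod b ?r = 0"
      using orth_expansion_residual[OF sys b v] comm_scalar_prod[OF _ r] by simp
    then show "scalar_prod s b / scalar_prod b b * scalar_prod b ?r = 0" by simp
  qed
  finally show ?thesis .
qed

text \<open>
  The expansion has the two defining properties of the projection, and these determine a vector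
  uniquely: the difference of two solutions lies in \<open>S\<close> and is orthogonal to itself.
\<close>
lemma orth_proj_eq_orth_expansion:
  assumes S: "vec_subspace n S" and B: "orthogonal_basis n S B" and v: "v \<in> carrier_vec n"
  shows "orth_proj S v = orth_expansion n B v"
  unfolding orth_proj_def
proof (rule the_equality)
  let ?w = "orth_expansion n B v"
  show ex: "?w \<in> S \<and> (\<forall>s\<in>S. scalar_prod (v - ?w) s = 0)"
    using S B orthogonal_basis_residual[OF S B v] orth_expansion_in_subspace[OF S]
    by (auto simp: orthogonal_basis_def)
  fix w assume w: "w \<in> S \<and> (\<forall>s\<in>S. scalar_prod (v - w) s = 0)"
  have wc: "w \<in> carrier_vec n" using S w by (auto simp: vec_subspace_iff)
  have d: "w - ?w \<in> S"
    using S w ex by (intro vec_subspace_diff) auto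
  have dc: "w - ?w \<in> carrier_vec n" using wc by simp
  have "w - ?w = (v - ?w) - (v - w)"
    using v wc by (intro eq_vecI) auto
  then have "scalar_prod (w - ?w) (w - ?w) = scalar_prod (v - ?w) (w - ?w) - scalar_prod (v - w) (w - ?w)"
    using minus_scalar_prod_distrib[of "v - ?w" n "v - w" "w - ?w"] v wc dc by simp
  also have "\<dots> = 0" using w ex d by simp
  finally have z: "w - ?w = 0\<^sub>v n"
    using scalar_prod_self_eq_0_iff[OF dc] by simp
  have "w = ?w + (w - ?w)"
    using wc by (intro eq_vecI) auto
  then show "w = ?w" using z by simp
qed

text \<open>
  Descending chains of subspaces become stationary.  Concretely, choose \<open>K\<close> in the family
  together with an orthogonal system \<open>B\<close> in its orthogonal complement so that \<open>B\<close> is as large as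
  possible.  If \<open>K\<close> were not contained in some \<open>K'\<close>, then \<open>K \<inter> K'\<close> would be a proper subspace of
  \<open>K\<close>, and a nonzero vector of \<open>K\<close> orthogonal to \<open>K \<inter> K'\<close> would extend \<open>B\<close>.
\<close>
lemma least_of_inter_closed_subspaces:
  assumes nonempty: "K1 \<in> F" and sub: "\<And>K. K \<in> F \<Longrightarrow> vec_subspace n K"
    and inter: "\<And>K K'. K \<in> F \<Longrightarrow> K' \<in> F \<Longrightarrow> K \<inter> K' \<in> F"
  obtains K where "K \<in> F" "\<And>K'. K' \<in> F \<Longrightarrow> K \<subseteq> K'"
proof -
  define P where "P m \<longleftrightarrow>
    (\<exists>K\<in>F. \<exists>B. orthogonal_system n B \<and> (\<forall>b\<in>B. \<forall>s\<in>K. scalar_prod b s = 0) \<and> card B = m)" for m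
  have "P 0"
    using nonempty by (auto simp: P_def orthogonal_system_def intro!: bexI[of _ K1] exI[of _ "{}"])
  moreover have bound: "\<forall>m. P m \<longrightarrow> m \<le> n"
    using card_orthogonal_system_le by (auto simp: P_def)
  ultimately have "P (Greatest P)"
    by (metis GreatestI_nat)
  then obtain K B where K: "K \<in> F" and B: "orthogonal_system n B" "card B = Greatest P"
    and orth: "\<And>b s. b \<in> B \<Longrightarrow> s \<in> K \<Longrightarrow> scalar_prod b s = 0"
    by (auto simp: P_def)
  have "K \<subseteq> K'" if K': "K' \<in> F" for K'
  proof
    fix s assume s: "s \<in> K"
    have J: "K \<inter> K' \<in> F" using K K' inter by blast
    from orthogonal_basis_exists[OF sub[OF J]] obtain C where C: "orthogonal_basis n (K \<inter> K') C" .
    define r where "r = s - orth_expansion n C s"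
    have sc: "s \<in> carrier_vec n" using sub[OF K] s by (auto simp: vec_subspace_iff)
    have eJ: "orth_expansion n C s \<in> K \<inter> K'"
      using C orth_expansion_in_subspace[OF sub[OF J]] by (auto simp: orthogonal_basis_def)
    have rK: "r \<in> K" unfolding r_def using sub[OF K] s eJ by (intro vec_subspace_diff) auto
    have rc: "r \<in> carrier_vec n" using sub[OF K] rK by (auto simp: vec_subspace_iff)
    have r_orth: "scalar_prod r t = 0" if "t \<in> K \<inter> K'" for t
      unfolding r_def using orthogonal_basis_residual[OF sub[OF J] C sc that] .
    have "r = 0\<^sub>v n"
    proof (rule ccontr)
      assume nz: "r \<noteq> 0\<^sub>v n"
      have "scalar_prod r b = 0" if "b \<in> B" for b
        using orth[OF that rK] B(1) that rc comm_scalar_prod[of b n r]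
        by (auto simp: orthogonal_system_def)
      from orthogonal_system_insert[OF B(1) rc nz this]
      have sys: "orthogonal_system n (insert r B)" and "r \<notin> B" by auto
      then have "card (insert r B) = Suc (card B)"
        using B(1) by (simp add: orthogonal_system_def)
      then have "P (Suc (card B))"
        unfolding P_def using J sys orth r_orth
        by (intro bexI[of _ "K \<inter> K'"] exI[of _ "insert r B"]) auto
      then show False
        using Greatest_le_nat[of P "Suc (card B)" n] bound B(2) by auto
    qed
    moreover have "s = orth_expansion n C s + r"
      unfolding r_def using sc by (intro eq_vecI) auto
    ultimately have "s = orth_expansion n C s" by simp
    then show "s \<in> K'" using eJ by (metis IntD2)
  qed
  with K that show ?thesis by blast
qed

section \<open>Kronecker products of subspaces\<close>

lemma block_index_less:
  fixes i j n p :: nat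
  assumes "i < n" "j < p"
  shows "i * p + j < n * p"
proof -
  have "i * p + j < Suc i * p" using assms by simp
  also have "\<dots> \<le> n * p" using assms by (intro mult_le_mono1) simp
  finally show ?thesis .
qed

lemma eq_vec_blockI:
  assumes "x \<in> carrier_vec (n * p)" "y \<in> carrier_vec (n * p)"
    and "\<And>i j. i < n \<Longrightarrow> j < p \<Longrightarrow> x $ (i * p + j) = y $ (i * p + j)"
  shows "x = y"
proof (rule eq_vecI)
  fix k assume "k < dim_vec y"
  then have k: "k < n * p" using assms by simp
  then have "p > 0" by (cases p) auto
  then have "k div p < n" "k mod p < p"
    using k by (auto simp: less_mult_imp_div_less)
  from assms(3)[OF this] show "x $ k = y $ k" by simp
qed (use assms in simp)

lemma dim_kron_vec [simp]: "dim_vec (kron_vec a b) = dim_vec a * dim_vec b"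
  by (simp add: kron_vec_def)

lemma index_kron_vec:
  assumes "i < dim_vec a" "j < p" "dim_vec b = p"
  shows "kron_vec a b $ (i * p + j) = a $ i * b $ j"
proof -
  have "(i * p + j) div p = i" "(i * p + j) mod p = j"
    using assms(2) by auto
  then show ?thesis
    using block_index_less[OF assms(1,2)] assms by (simp add: kron_vec_def)
qed

lemma kron_vec_carrier:
  "a \<in> carrier_vec n \<Longrightarrow> b \<in> carrier_vec p \<Longrightarrow> kron_vec a b \<in> carrier_vec (n * p)"
  by (intro carrier_vecI) simp

lemma kron_vec_add_left:
  assumes a: "a \<in> carrier_vec n" and b: "b \<in> carrier_vec n" and s: "s \<in> carrier_vec p"
  shows "kron_vec (a + b) s = kron_vec a s + kron_vec b s"
proof (rule eq_vec_blockI[where n = n and p = p])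
  fix i j assume ij: "i < n" "j < p"
  from ij have "i * p + j < n * p"
    by (rule block_index_less)
  then show "kron_vec (a + b) s $ (i * p + j) = (kron_vec a s + kron_vec b s) $ (i * p + j)"
    using a b s ij by (simp add: index_kron_vec distrib_right)
qed (use a b s in \<open>simp_all add: kron_vec_carrier\<close>)

lemma kron_vec_smult_left:
  assumes a: "a \<in> carrier_vec n" and s: "s \<in> carrier_vec p"
  shows "kron_vec (c \<cdot>\<^sub>v a) s = c \<cdot>\<^sub>v kron_vec a s"
proof (rule eq_vec_blockI[where n = n and p = p])
  fix i j assume ij: "i < n" "j < p"
  from ij have "i * p + j < n * p"
    by (rule block_index_less)
  then show "kron_vec (c \<cdot>\<^sub>v a) s $ (i * p + j) = (c \<cdot>\<^sub>v kron_vec a s) $ (i * p + j)"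
    using a s ij by (simp add: index_kron_vec)
qed (use a s in \<open>simp_all add: kron_vec_carrier\<close>)

lemma kron_vec_zero_left:
  assumes s: "s \<in> carrier_vec p"
  shows "kron_vec (0\<^sub>v n) s = 0\<^sub>v (n * p)"
proof (rule eq_vec_blockI[where n = n and p = p])
  fix i j assume ij: "i < n" "j < p"
  from ij have "i * p + j < n * p"
    by (rule block_index_less)
  then show "kron_vec (0\<^sub>v n) s $ (i * p + j) = 0\<^sub>v (n * p) $ (i * p + j)"
    using s ij by (simp add: index_kron_vec)
qed (use s in \<open>simp_all add: kron_vec_carrier\<close>)

lemma kron_vecs_carrier:
  assumes "list_all2 vec_subspace ps Ss" "list_all2 (\<in>) vs Ss"
  shows "kron_vecs vs \<in> carrier_vec (prod_list ps)"
  using assms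
proof (induction arbitrary: vs rule: list_all2_induct)
  case (Cons p ps S Ss)
  from Cons.prems obtain v ws where vs: "vs = v # ws" "v \<in> S" "list_all2 (\<in>) ws Ss"
    by (auto simp: list_all2_Cons2)
  have "v \<in> carrier_vec p" using Cons.hyps(1) vs(2) by (auto simp: vec_subspace_iff)
  then show ?case
    using kron_vec_carrier[OF Cons.IH[OF vs(3)]] vs(1) by (simp add: mult.commute)
qed auto

lemma vec_subspace_kron_space:
  assumes "list_all2 vec_subspace ps Ss"
  shows "vec_subspace (prod_list ps) (kron_space ps Ss)"
  unfolding kron_space_def using kron_vecs_carrier[OF assms] by (intro vec_subspace_span) auto

lemma kron_vecs_in_kron_space:
  assumes "list_all2 vec_subspace ps Ss" "list_all2 (\<in>) vs Ss"
  shows "kron_vecs vs \<in> kron_space ps Ss"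
  unfolding kron_space_def
  using vec_span_superset[of "{kron_vecs vs |vs. list_all2 (\<in>) vs Ss}" "prod_list ps"]
    kron_vecs_carrier[OF assms(1)] assms(2)
  by blast

lemma kron_space_least:
  assumes "vec_subspace (prod_list ps) T" "\<And>vs. list_all2 (\<in>) vs Ss \<Longrightarrow> kron_vecs vs \<in> T"
  shows "kron_space ps Ss \<subseteq> T"
  unfolding kron_space_def using assms by (intro vec_span_least) auto

text \<open>
  For fixed \<open>s\<close>, the vectors \<open>t\<close> satisfying the claim form a subspace, and this subspace contains
  the generators of the Kronecker product of the remaining factors.
\<close>
lemma kron_vec_in_kron_space:
  assumes S: "vec_subspace p S" and Ss: "list_all2 vec_subspace ps Ss"
    and s: "s \<in> S" and t: "t \<in> kron_space ps Ss"
  shows "kron_vec t s \<in> kron_space (p # ps) (S # Ss)"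
proof -
  let ?n = "prod_list ps" and ?K = "kron_space (p # ps) (S # Ss)"
  let ?T = "{t \<in> carrier_vec ?n. kron_vec t s \<in> ?K}"
  have all: "list_all2 vec_subspace (p # ps) (S # Ss)" using S Ss by simp
  note K = vec_subspace_kron_space[OF all]
  have sc: "s \<in> carrier_vec p" using S s by (auto simp: vec_subspace_iff)
  have "vec_subspace ?n ?T"
    using K sc
    by (auto simp: vec_subspace_iff kron_vec_smult_left[of _ ?n] kron_vec_zero_left
        kron_vec_add_left[of _ ?n] mult.commute)
  then have "kron_space ps Ss \<subseteq> ?T"
  proof (rule kron_space_least)
    fix vs assume vs: "list_all2 (\<in>) vs Ss"
    then have "kron_vecs (s # vs) \<in> ?K"
      using s by (intro kron_vecs_in_kron_space[OF all]) simp
    then show "kron_vecs vs \<in> ?T"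
      using kron_vecs_carrier[OF Ss vs] by simp
  qed
  with t show ?thesis by auto
qed

text \<open>
  A vector of length \<open>n * p\<close> is read as an \<open>n\<close> by \<open>p\<close> matrix stored row by row; its rows are
  required to lie in \<open>S\<close> and its columns in \<open>T\<close>.  Unlike a span of Kronecker products, this
  description is evidently compatible with intersections.
\<close>
definition fibre_space :: "nat \<Rightarrow> nat \<Rightarrow> real vec set \<Rightarrow> real vec set \<Rightarrow> real vec set" where
  "fibre_space n p T S = {x \<in> carrier_vec (n * p).
     (\<forall>i<n. vec p (\<lambda>j. x $ (i * p + j)) \<in> S) \<and> (\<forall>j<p. vec n (\<lambda>i. x $ (i * p + j)) \<in> T)}"

lemma vec_subspace_fibre_space:
  assumes T: "vec_subspace n T" and S: "vec_subspace p S"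
  shows "vec_subspace (n * p) (fibre_space n p T S)"
proof -
  have add: "vec m (\<lambda>i. (x + y) $ f i) = vec m (\<lambda>i. x $ f i) + vec m (\<lambda>i. y $ f i)"
    if "\<And>i. i < m \<Longrightarrow> f i < n * p" "x \<in> carrier_vec (n * p)" "y \<in> carrier_vec (n * p)"
    for m f and x y :: "real vec"
    using that by (auto intro!: eq_vecI)
  have smult: "vec m (\<lambda>i. (c \<cdot>\<^sub>v x) $ f i) = c \<cdot>\<^sub>v vec m (\<lambda>i. x $ f i)"
    if "\<And>i. i < m \<Longrightarrow> f i < n * p" "x \<in> carrier_vec (n * p)"
    for m f c and x :: "real vec"
    using that by (auto intro!: eq_vecI)
  have zero: "vec m (\<lambda>i. 0\<^sub>v (n * p) $ f i) = (0\<^sub>v m :: real vec)"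
    if "\<And>i. i < m \<Longrightarrow> f i < n * p" for m f
    using that by (auto intro!: eq_vecI)
  show ?thesis
    unfolding vec_subspace_iff
  proof (intro conjI ballI allI)
    show "fibre_space n p T S \<subseteq> carrier_vec (n * p)"
      by (auto simp: fibre_space_def)
    show "0\<^sub>v (n * p) \<in> fibre_space n p T S"
      using S T by (simp add: fibre_space_def zero block_index_less vec_subspace_iff)
    show "a + b \<in> fibre_space n p T S"
      if "a \<in> fibre_space n p T S" "b \<in> fibre_space n p T S" for a b
      using that S T by (simp add: fibre_space_def add block_index_less vec_subspace_iff)
    show "c \<cdot>\<^sub>v a \<in> fibre_space n p T S" if "a \<in> fibre_space n p T S" for c a
      using that S T by (simp add: fibre_space_def smult block_index_less vec_subspace_iff)
  qed
qed

lemma kron_vec_in_fibre_space: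
  assumes T: "vec_subspace n T" and S: "vec_subspace p S" and t: "t \<in> T" and s: "s \<in> S"
  shows "kron_vec t s \<in> fibre_space n p T S"
proof -
  have carrier: "t \<in> carrier_vec n" "s \<in> carrier_vec p"
    using assms by (auto simp: vec_subspace_iff)
  then have dim: "dim_vec t = n" "dim_vec s = p" by auto
  have "vec p (\<lambda>j. kron_vec t s $ (i * p + j)) = t $ i \<cdot>\<^sub>v s" if "i < n" for i
    using that index_kron_vec[of i t _ p s] dim by (auto intro!: eq_vecI)
  moreover have "vec n (\<lambda>i. kron_vec t s $ (i * p + j)) = s $ j \<cdot>\<^sub>v t" if "j < p" for j
    using that index_kron_vec[of _ t j p s] dim by (auto intro!: eq_vecI)
  ultimately show ?thesis
    using assms kron_vec_carrier[OF carrier] by (auto simp: fibre_space_def vec_subspace_iff)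
qed

text \<open>
  One inclusion holds because both fibres of \<open>kron_vec t s\<close> are multiples of \<open>s\<close> and \<open>t\<close>.  For the
  other, expand every row of \<open>x\<close> along an orthogonal basis \<open>B\<close> of \<open>S\<close>.  The coefficients that belong
  to one \<open>b\<close> form a linear combination of the columns of \<open>x\<close>, hence a vector of the other factor,
  and \<open>x\<close> is the sum over \<open>b\<close> of the Kronecker products of these vectors with \<open>b\<close>.
\<close>
lemma kron_space_Cons:
  assumes S: "vec_subspace p S" and Ss: "list_all2 vec_subspace ps Ss"
  shows "kron_space (p # ps) (S # Ss) = fibre_space (prod_list ps) p (kron_space ps Ss) S"
    (is "?K = ?F")
proof
  let ?n = "prod_list ps" and ?T = "kron_space ps Ss"
  note T = vec_subspace_kron_space[OF Ss]
  have all: "list_all2 vec_subspace (p # ps) (S # Ss)" using S Ss by simp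
  note K = vec_subspace_kron_space[OF all]
  show "?K \<subseteq> ?F"
  proof (rule kron_space_least)
    show "vec_subspace (prod_list (p # ps)) ?F"
      using vec_subspace_fibre_space[OF T S] by (simp add: mult.commute)
    fix vs assume "list_all2 (\<in>) vs (S # Ss)"
    then obtain v ws where vs: "vs = v # ws" "v \<in> S" "list_all2 (\<in>) ws Ss"
      by (auto simp: list_all2_Cons2)
    then show "kron_vecs vs \<in> ?F"
      using kron_vec_in_fibre_space[OF T S kron_vecs_in_kron_space[OF Ss vs(3)] vs(2)] by simp
  qed
  show "?F \<subseteq> ?K"
  proof
    fix x assume x: "x \<in> ?F"
    define row col where "row i = vec p (\<lambda>j. x $ (i * p + j))"
      and "col j = vec ?n (\<lambda>i. x $ (i * p + j))" for i j
    have row: "row i \<in> S" if "i < ?n" for i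
      using x that by (simp add: fibre_space_def row_def)
    have col: "col j \<in> ?T" if "j < p" for j
      using x that by (simp add: fibre_space_def col_def)
    from orthogonal_basis_exists[OF S] obtain B where B: "orthogonal_basis p S B" .
    have BS: "B \<subseteq> S" and row_eq: "\<And>i. i < ?n \<Longrightarrow> orth_expansion p B (row i) = row i"
      using B row by (auto simp: orthogonal_basis_def)
    have dim: "dim_vec b = p" if "b \<in> B" for b
      using that BS S by (auto simp: vec_subspace_iff)
    \<comment> \<open>The vector of the coefficients at \<open>b\<close>, written as a combination of columns to see that it
        lies in the other factor.\<close>
    define t where "t b = vec ?n (\<lambda>i. \<Sum>j<p. b $ j / scalar_prod b b * col j $ i)" for b
    have t: "t b \<in> ?T" for b
      unfolding t_def by (intro vec_subspace_sum[OF T] col) auto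
    have t_index: "t b $ i = scalar_prod (row i) b / scalar_prod b b"
      if "b \<in> B" "i < ?n" for b i
      using that dim
      by (auto simp: t_def row_def col_def scalar_prod_def[of "vec _ _"] atLeast0LessThan
          sum_divide_distrib mult.commute intro!: sum.cong)
    have "x = vec (prod_list (p # ps)) (\<lambda>k. \<Sum>b\<in>B. 1 * kron_vec (t b) b $ k)"
    proof (rule eq_vec_blockI[where n = ?n and p = p])
      fix i j assume ij: "i < ?n" "j < p"
      then have k: "i * p + j < p * ?n"
        using block_index_less by (metis mult.commute)
      have "x $ (i * p + j) = orth_expansion p B (row i) $ j"
        using ij row_eq by (simp add: row_def)
      also have "\<dots> = (\<Sum>b\<in>B. t b $ i * b $ j)"
        using ij by (simp add: orth_expansion_def t_index)
      also have "\<dots> = (\<Sum>b\<in>B. 1 * kron_vec (t b) b $ (i * p + j))"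
        using ij dim index_kron_vec[of i "t _" j p] by (intro sum.cong) (auto simp: t_def)
      finally show "x $ (i * p + j)
          = vec (prod_list (p # ps)) (\<lambda>k. \<Sum>b\<in>B. 1 * kron_vec (t b) b $ k) $ (i * p + j)"
        using k by simp
    qed (use x in \<open>auto simp: fibre_space_def mult.commute\<close>)
    also have "\<dots> \<in> ?K"
      using BS t by (intro vec_subspace_sum[OF K] kron_vec_in_kron_space[OF S Ss]) auto
    finally show "x \<in> ?K" .
  qed
qed

lemma vec_subspace_Int: "vec_subspace n S \<Longrightarrow> vec_subspace n S' \<Longrightarrow> vec_subspace n (S \<inter> S')"
  by (auto simp: vec_subspace_iff)

text \<open>
  For bare spans this is not apparent, but for the fibre description it is a matter of logic.
\<close>
lemma kron_space_Int:
  assumes "list_all2 vec_subspace ps Ss" "list_all2 vec_subspace ps Ss'"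
  shows "list_all2 vec_subspace ps (map2 (\<inter>) Ss Ss')"
    and "kron_space ps (map2 (\<inter>) Ss Ss') = kron_space ps Ss \<inter> kron_space ps Ss'"
proof -
  have "list_all2 vec_subspace ps (map2 (\<inter>) Ss Ss') \<and>
      kron_space ps (map2 (\<inter>) Ss Ss') = kron_space ps Ss \<inter> kron_space ps Ss'"
    using assms
  proof (induction arbitrary: Ss' rule: list_all2_induct)
    case (Cons p ps S Ss)
    from Cons.prems obtain S' Ts where Ss': "Ss' = S' # Ts" "vec_subspace p S'"
        "list_all2 vec_subspace ps Ts"
      by (auto simp: list_all2_Cons1)
    have IH: "list_all2 vec_subspace ps (map2 (\<inter>) Ss Ts)"
        "kron_space ps (map2 (\<inter>) Ss Ts) = kron_space ps Ss \<inter> kron_space ps Ts"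
      using Cons.IH[OF Ss'(3)] by auto
    have SS: "vec_subspace p (S \<inter> S')"
      using Cons.hyps(1) Ss'(2) by (rule vec_subspace_Int)
    have "kron_space (p # ps) ((S \<inter> S') # map2 (\<inter>) Ss Ts)
        = fibre_space (prod_list ps) p (kron_space ps Ss \<inter> kron_space ps Ts) (S \<inter> S')"
      using kron_space_Cons[OF SS IH(1)] IH(2) by simp
    also have "\<dots> = fibre_space (prod_list ps) p (kron_space ps Ss) S
        \<inter> fibre_space (prod_list ps) p (kron_space ps Ts) S'"
      by (auto simp: fibre_space_def)
    finally show ?case
      using Ss' SS IH(1) Cons.hyps kron_space_Cons by simp
  qed auto
  then show "list_all2 vec_subspace ps (map2 (\<inter>) Ss Ss')"
    and "kron_space ps (map2 (\<inter>) Ss Ss') = kron_space ps Ss \<inter> kron_space ps Ss'"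
    by auto
qed

lemma dim_kron_mat [simp]:
  "dim_row (kron_mat A B) = dim_row A * dim_row B" "dim_col (kron_mat A B) = dim_col A * dim_col B"
  by (simp_all add: kron_mat_def)

lemma div_mod_less_blocks:
  fixes k n p :: nat
  assumes "k < n * p"
  shows "k div p < n" "k mod p < p"
  using assms by (cases "p = 0"; simp add: less_mult_imp_div_less)+

lemma sum_div_mod:
  fixes f :: "nat \<Rightarrow> nat \<Rightarrow> real"
  shows "(\<Sum>l<m * d. f (l div d) (l mod d)) = (\<Sum>i<m. \<Sum>j<d. f i j)"
proof -
  have "(\<Sum>l<m * d. f (l div d) (l mod d)) = (\<Sum>(i, j)\<in>{..<m} \<times> {..<d}. f i j)"
    by (rule sum.reindex_bij_witness[of _ "\<lambda>(i, j). i * d + j" "\<lambda>l. (l div d, l mod d)"])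
       (auto simp: block_index_less div_mod_less_blocks)
  then show ?thesis by (simp add: sum.cartesian_product)
qed

text \<open>The mixed-product property.\<close>
lemma kron_mat_mult_kron_vec:
  assumes "a \<in> carrier_vec (dim_col A)" "b \<in> carrier_vec (dim_col B)"
  shows "kron_mat A B *\<^sub>v kron_vec a b = kron_vec (A *\<^sub>v a) (B *\<^sub>v b)"
proof (rule eq_vecI)
  fix k assume "k < dim_vec (kron_vec (A *\<^sub>v a) (B *\<^sub>v b))"
  then have k: "k < dim_row A * dim_row B" by simp
  note k' = div_mod_less_blocks[OF k]
  let ?i = "k div dim_row B" and ?j = "k mod dim_row B"
  have "(kron_mat A B *\<^sub>v kron_vec a b) $ k = (\<Sum>l<dim_col A * dim_col B.
      (A $$ (?i, l div dim_col B) * a $ (l div dim_col B)) *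
      (B $$ (?j, l mod dim_col B) * b $ (l mod dim_col B)))"
    using k assms
    by (auto simp: kron_mat_def kron_vec_def scalar_prod_def atLeast0LessThan intro!: sum.cong)
  also have "\<dots> = (\<Sum>i<dim_col A. \<Sum>j<dim_col B. (A $$ (?i, i) * a $ i) * (B $$ (?j, j) * b $ j))"
    by (rule sum_div_mod)
  also have "\<dots> = (A *\<^sub>v a) $ ?i * (B *\<^sub>v b) $ ?j"
    using k' assms by (simp add: scalar_prod_def atLeast0LessThan sum_product)
  also have "\<dots> = kron_vec (A *\<^sub>v a) (B *\<^sub>v b) $ k"
    using k by (simp add: kron_vec_def)
  finally show "(kron_mat A B *\<^sub>v kron_vec a b) $ k = kron_vec (A *\<^sub>v a) (B *\<^sub>v b) $ k" .
qed simp

lemma col_kron_mat: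
  assumes "l < dim_col A * dim_col B"
  shows "col (kron_mat A B) l = kron_vec (col A (l div dim_col B)) (col B (l mod dim_col B))"
  using assms div_mod_less_blocks[OF assms]
  by (intro eq_vecI) (auto simp: kron_mat_def kron_vec_def div_mod_less_blocks)

lemma vec_subspace_col_space: "dim_row A = n \<Longrightarrow> vec_subspace n (col_space n A)"
  unfolding vec_space.col_space_def using cols_dim[of A] by (intro vec_subspace_span) simp

lemma col_in_col_space:
  assumes "dim_row A = n" "j < dim_col A"
  shows "col A j \<in> col_space n A"
  unfolding vec_space.col_space_def
  using vec_span_superset[of "set (cols A)" n] cols_dim[of A] assms by (auto simp: cols_def)

lemma col_space_eq_range:
  assumes "dim_row A = n"
  shows "col_space n A = (*\<^sub>v) A ` carrier_vec (dim_col A)"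
proof -
  have A: "A \<in> carrier_mat n (dim_col A)" using assms by (intro carrier_matI) simp_all
  show ?thesis
    unfolding vec_space.col_space_eq[OF A] assms
    using mult_mat_vec_carrier[OF A] by blast
qed

lemma dim_row_kron_mats:
  "list_all2 (\<lambda>p A. dim_row A = p) ps As \<Longrightarrow> dim_row (kron_mats As) = prod_list ps"
  by (induction rule: list_all2_induct) auto

lemma vec_subspace_col_spaces:
  "list_all2 (\<lambda>p A. dim_row A = p) ps As \<Longrightarrow> list_all2 vec_subspace ps (map2 col_space ps As)"
  by (induction rule: list_all2_induct) (auto simp: vec_subspace_col_space)

text \<open>
  The columns of a Kronecker product of matrices are Kronecker products of columns; conversely,
  the mixed-product property puts a Kronecker product of elements of the column spaces into the
  range of the product matrix.
\<close>
lemma col_space_kron_mats: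
  assumes "list_all2 (\<lambda>p A. dim_row A = p) ps As"
  shows "col_space (prod_list ps) (kron_mats As) = kron_space ps (map2 col_space ps As)"
    (is "?C = ?K")
proof
  let ?n = "prod_list ps"
  note dim = dim_row_kron_mats[OF assms] and subs = vec_subspace_col_spaces[OF assms]
  have "\<exists>vs. list_all2 (\<in>) vs (map2 col_space ps As) \<and> col (kron_mats As) l = kron_vecs vs"
    if "l < dim_col (kron_mats As)" for l
    using assms that
  proof (induction arbitrary: l rule: list_all2_induct)
    case Nil
    then show ?case by (auto intro!: eq_vecI)
  next
    case (Cons p ps A As)
    have l: "l < dim_col (kron_mats As) * dim_col A" using Cons.prems by simp
    note l' = div_mod_less_blocks[OF l]
    from Cons.IH[OF l'(1)] obtain vs where
      "list_all2 (\<in>) vs (map2 col_space ps As)" "col (kron_mats As) (l div dim_col A) = kron_vecs vs"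
      by blast
    then show ?case
      using col_in_col_space[OF Cons.hyps(1) l'(2)] col_kron_mat[OF l]
      by (intro exI[of _ "col A (l mod dim_col A) # vs"]) simp
  qed
  then have "col (kron_mats As) l \<in> ?K" if "l < dim_col (kron_mats As)" for l
    using that kron_vecs_in_kron_space[OF subs] by metis
  then have "set (cols (kron_mats As)) \<subseteq> ?K"
    by (auto simp: cols_def)
  then have "vec_span ?n (set (cols (kron_mats As))) \<subseteq> ?K"
    by (rule vec_span_least[OF _ vec_subspace_kron_space[OF subs]])
  then show "?C \<subseteq> ?K"
    by (simp only: vec_space.col_space_def)
  have gen: "\<exists>c\<in>carrier_vec (dim_col (kron_mats As)). kron_vecs vs = kron_mats As *\<^sub>v c"
    if "list_all2 (\<in>) vs (map2 col_space ps As)" for vs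
    using assms that
  proof (induction arbitrary: vs rule: list_all2_induct)
    case Nil
    then show ?case
      by (auto intro!: bexI[of _ "vec 1 (\<lambda>_. 1)"] eq_vecI)
  next
    case (Cons p ps A As)
    from Cons.prems obtain v ws where vs: "vs = v # ws" "v \<in> col_space p A"
        "list_all2 (\<in>) ws (map2 col_space ps As)"
      by (auto simp: list_all2_Cons2)
    from Cons.IH[OF vs(3)] obtain c where c: "c \<in> carrier_vec (dim_col (kron_mats As))"
        "kron_vecs ws = kron_mats As *\<^sub>v c" by blast
    from vs(2) obtain d where d: "d \<in> carrier_vec (dim_col A)" "v = A *\<^sub>v d"
      using col_space_eq_range[OF Cons.hyps(1)] by auto
    show ?case
      using c d vs(1) kron_mat_mult_kron_vec[OF c(1) d(1)]
      by (intro bexI[of _ "kron_vec c d"]) (auto intro: kron_vec_carrier)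
  qed
  show "?K \<subseteq> ?C"
    using gen vec_subspace_col_space[OF dim] col_space_eq_range[OF dim]
    by (intro kron_space_least) auto
qed

section \<open>Measurability and conditional independence\<close>

lemma space_borel_vec [simp]: "space (borel_vec n) = carrier_vec n"
  by (simp add: borel_vec_def)

lemma measurable_borel_vecI:
  assumes "\<And>x. x \<in> space N \<Longrightarrow> f x \<in> carrier_vec n"
    and "\<And>i. i < n \<Longrightarrow> (\<lambda>x. f x $ i) \<in> borel_measurable N"
  shows "f \<in> measurable N (borel_vec n)"
  unfolding borel_vec_def
proof (rule measurable_vimage_algebra2)
  show "(\<lambda>x. \<lambda>i\<in>{..<n}. f x $ i) \<in> measurable N (\<Pi>\<^sub>M i\<in>{..<n}. borel)"
    by (rule measurable_restrict) (use assms in auto)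
qed (use assms in auto)

lemma measurable_vec_index:
  assumes "i < n"
  shows "(\<lambda>v. v $ i) \<in> borel_measurable (borel_vec n)"
proof -
  have "(\<lambda>v. \<lambda>i\<in>{..<n}. v $ i) \<in> measurable (borel_vec n) (\<Pi>\<^sub>M i\<in>{..<n}. borel :: real measure)"
    unfolding borel_vec_def by (rule measurable_vimage_algebra1) (auto simp: space_PiM)
  from measurable_compose[OF this measurable_component_singleton[of i "{..<n}"]] assms
  show ?thesis by simp
qed

lemma measurable_scalar_prod:
  assumes "c \<in> carrier_vec n"
  shows "(\<lambda>v. scalar_prod v c) \<in> borel_measurable (borel_vec n)"
  unfolding scalar_prod_def using assms
  by (intro borel_measurable_sum borel_measurable_times measurable_vec_index) auto

lemma measurable_mult_mat_vec:
  assumes "A \<in> carrier_mat m n"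
  shows "(*\<^sub>v) A \<in> measurable (borel_vec n) (borel_vec m)"
proof (rule measurable_borel_vecI)
  fix i assume i: "i < m"
  then have row: "row A i \<in> carrier_vec n" using assms by auto
  have "(\<lambda>v. (A *\<^sub>v v) $ i) \<in> borel_measurable (borel_vec n) \<longleftrightarrow>
      (\<lambda>v. scalar_prod v (row A i)) \<in> borel_measurable (borel_vec n)"
    using i assms row by (intro measurable_cong) (auto simp: comm_scalar_prod[of _ n])
  then show "(\<lambda>v. (A *\<^sub>v v) $ i) \<in> borel_measurable (borel_vec n)"
    using measurable_scalar_prod[OF row] by simp
qed (use assms in auto)

lemma list_all2_multi_index: "k < prod_list ps \<Longrightarrow> list_all2 (<) (multi_index ps k) ps"
proof (induction ps k rule: multi_index.induct)
  case (2 p ps k)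
  then have "k < prod_list ps * p" by (simp add: mult.commute)
  from div_mod_less_blocks[OF this] 2 show ?case by simp
qed simp

lemma vec_array_carrier [simp]: "vec_array ps x \<in> carrier_vec (prod_list ps)"
  by (simp add: vec_array_def)

lemma measurable_vec_array: "vec_array ps \<in> measurable (borel_array ps) (borel_vec (prod_list ps))"
proof (rule measurable_borel_vecI)
  fix k assume k: "k < prod_list ps"
  then have "(\<lambda>x. x (multi_index ps k)) \<in> borel_measurable (borel_array ps)"
    unfolding borel_array_def
    by (intro measurable_component_singleton) (simp add: list_all2_multi_index)
  then show "(\<lambda>x. vec_array ps x $ k) \<in> borel_measurable (borel_array ps)"
    using k by (simp add: vec_array_def)
qed simp

lemma sets_vimage_algebra_mono:
  assumes Z: "Z \<in> measurable M N" and g: "g \<in> measurable N N'"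
    and Z': "\<And>\<omega>. \<omega> \<in> space M \<Longrightarrow> Z' \<omega> = g (Z \<omega>)"
  shows "sets (vimage_algebra (space M) Z' N') \<subseteq> sets (vimage_algebra (space M) Z N)"
proof (rule sets_image_in_sets)
  have "(\<lambda>\<omega>. g (Z \<omega>)) \<in> measurable (vimage_algebra (space M) Z N) N'"
    using measurable_space[OF Z] by (intro measurable_compose[OF measurable_vimage_algebra1 g]) auto
  then show "Z' \<in> measurable (vimage_algebra (space M) Z N) N'"
    using Z' by (subst measurable_cong[where g = "\<lambda>\<omega>. g (Z \<omega>)"]) auto
qed simp

text \<open>
  The conditioning variable matters only through the \<open>\<sigma>\<close>-algebra it generates, and it may be
  exchanged for any variable from which it can be measurably recovered and vice versa.
\<close>
lemma cond_indep_var_transfer: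
  assumes indep: "cond_indep_var M N\<^sub>Y Y N\<^sub>X X N\<^sub>Z Z"
    and f: "f \<in> measurable N\<^sub>X N\<^sub>X'"
    and g: "g \<in> measurable N\<^sub>Z N\<^sub>Z'" "\<And>\<omega>. \<omega> \<in> space M \<Longrightarrow> Z' \<omega> = g (Z \<omega>)"
    and h: "h \<in> measurable N\<^sub>Z' N\<^sub>Z" "\<And>\<omega>. \<omega> \<in> space M \<Longrightarrow> Z \<omega> = h (Z' \<omega>)"
  shows "cond_indep_var M N\<^sub>Y Y N\<^sub>X' (\<lambda>\<omega>. f (X \<omega>)) N\<^sub>Z' Z'"
proof -
  let ?F = "vimage_algebra (space M) Z N\<^sub>Z" and ?F' = "vimage_algebra (space M) Z' N\<^sub>Z'"
  from indep have Y: "Y \<in> measurable M N\<^sub>Y" and X: "X \<in> measurable M N\<^sub>X"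
    and Z: "Z \<in> measurable M N\<^sub>Z"
    and prod: "\<And>A B. A \<in> sets N\<^sub>Y \<Longrightarrow> B \<in> sets N\<^sub>X \<Longrightarrow>
      AE \<omega> in M. real_cond_exp M ?F (indicator ((Y -` A \<inter> space M) \<inter> (X -` B \<inter> space M))) \<omega>
        = real_cond_exp M ?F (indicator (Y -` A \<inter> space M)) \<omega>
          * real_cond_exp M ?F (indicator (X -` B \<inter> space M)) \<omega>"
    unfolding cond_indep_var_def Let_def by auto
  have Z': "Z' \<in> measurable M N\<^sub>Z'"
    using measurable_compose[OF Z g(1)] g(2) by (subst measurable_cong) auto
  \<comment> \<open>Conditional expectations are indexed by measures, so equal \<open>\<sigma>\<close>-algebras do not suffice: the
      measure that \<open>vimage_algebra\<close> attaches to them vanishes in both cases.\<close>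
  have "sets ?F = sets ?F'"
    using sets_vimage_algebra_mono[OF Z g] sets_vimage_algebra_mono[OF Z' h] by auto
  then have F: "?F' = ?F"
    by (intro measure_eqI) (auto simp: vimage_algebra_def emeasure_sigma)
  have pre: "(\<lambda>\<omega>. f (X \<omega>)) -` B \<inter> space M = X -` (f -` B \<inter> space N\<^sub>X) \<inter> space M" for B
    using measurable_space[OF X] by auto
  show ?thesis
    unfolding cond_indep_var_def Let_def F pre
    using Y Z' measurable_compose[OF X f] prod measurable_sets[OF f] by blast
qed

section \<open>The envelope lies in every dimension-folding subspace\<close>

lemma folding_subspace_kron_space:
  assumes "folding_subspace M Y ps X T"
  obtains Ss where "list_all2 vec_subspace ps Ss" "T = kron_space ps Ss"
  using assms vec_subspace_col_spaces unfolding folding_subspace_def by blast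

text \<open>
  Put \<open>A = kron_mats As\<close>.  A vector \<open>b\<close> of the column space \<open>T\<close> has the form \<open>A c\<close>, so its scalar
  product with \<open>v\<close> equals that of \<open>c\<close> with \<open>A\<^sup>T v\<close>.  Expanding along an orthogonal basis of \<open>T\<close>
  therefore yields the projection of \<open>v\<close> as a measurable function of \<open>A\<^sup>T v\<close>.  Conversely, \<open>v\<close> and
  its projection have the same scalar products with the columns of \<open>A\<close>.
\<close>
lemma folding_subspace_imp_dr_subspace:
  assumes "folding_subspace M Y ps X T"
  shows "dr_subspace M Y (prod_list ps) (\<lambda>\<omega>. vec_array ps (X \<omega>)) T"
proof -
  let ?n = "prod_list ps"
  from assms obtain As where As: "list_all2 (\<lambda>p A. dim_row A = p) ps As"
    and T: "T = kron_space ps (map2 col_space ps As)"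
    and indep: "cond_indep_var M borel Y (borel_array ps) X (borel_vec (dim_col (kron_mats As)))
             (\<lambda>\<omega>. (kron_mats As)\<^sup>T *\<^sub>v vec_array ps (X \<omega>))"
    unfolding folding_subspace_def by blast
  define A d where "A = kron_mats As" and "d = dim_col (kron_mats As)"
  have A: "A \<in> carrier_mat ?n d"
    using dim_row_kron_mats[OF As] by (intro carrier_matI) (simp_all add: A_def d_def)
  have A': "A\<^sup>T \<in> carrier_mat d ?n" using A by simp
  have T_col: "T = col_space ?n A"
    unfolding T A_def by (rule col_space_kron_mats[OF As, symmetric])
  have dims: "dim_row A = ?n" "dim_col A = d" using A by auto
  have sub: "vec_subspace ?n T"
    unfolding T_col by (rule vec_subspace_col_space[OF dims(1)])
  have range: "T = (*\<^sub>v) A ` carrier_vec d"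
    unfolding T_col using col_space_eq_range[OF dims(1)] dims(2) by simp
  from orthogonal_basis_exists[OF sub] obtain B where B: "orthogonal_basis ?n T B" .
  then have "\<forall>b\<in>B. \<exists>c. c \<in> carrier_vec d \<and> b = A *\<^sub>v c"
    using range unfolding orthogonal_basis_def by blast
  then obtain c where c: "\<And>b. b \<in> B \<Longrightarrow> c b \<in> carrier_vec d" "\<And>b. b \<in> B \<Longrightarrow> b = A *\<^sub>v c b"
    by metis
  \<comment> \<open>The orthogonal expansion with \<open>scalar_prod v b\<close> replaced by its value in terms of
      \<open>z = A\<^sup>T v\<close>.\<close>
  define g where "g z = vec ?n (\<lambda>i. \<Sum>b\<in>B. scalar_prod z (c b) / scalar_prod b b * b $ i)" for z
  have g: "g \<in> measurable (borel_vec d) (borel_vec ?n)"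
  proof (rule measurable_borel_vecI)
    fix i assume "i < ?n"
    then show "(\<lambda>z. g z $ i) \<in> borel_measurable (borel_vec d)"
      using measurable_scalar_prod[OF c(1)] unfolding g_def
      by (auto intro!: borel_measurable_sum borel_measurable_times borel_measurable_divide)
  qed (simp add: g_def)
  have proj: "orth_proj T v = g (A\<^sup>T *\<^sub>v v)" if v: "v \<in> carrier_vec ?n" for v
  proof -
    have "scalar_prod (A\<^sup>T *\<^sub>v v) (c b) = scalar_prod v b" if b: "b \<in> B" for b
    proof -
      have "scalar_prod (A\<^sup>T *\<^sub>v v) (c b) = scalar_prod v (A *\<^sub>v c b)"
        using transpose_vec_mult_scalar[OF A c(1)[OF b] v] by simp
      then show ?thesis using c(2)[OF b] by simp
    qed
    then have "g (A\<^sup>T *\<^sub>v v) = orth_expansion ?n B v"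
      unfolding g_def orth_expansion_def by (intro eq_vecI) auto
    then show ?thesis
      using orth_proj_eq_orth_expansion[OF sub B v] by simp
  qed
  have recover: "A\<^sup>T *\<^sub>v v = A\<^sup>T *\<^sub>v orth_proj T v" if v: "v \<in> carrier_vec ?n" for v
  proof (rule eq_vecI)
    let ?w = "orth_expansion ?n B v"
    fix j assume "j < dim_vec (A\<^sup>T *\<^sub>v orth_proj T v)"
    then have j: "j < d" using dims by simp
    then have col: "col A j \<in> T" "col A j \<in> carrier_vec ?n"
      using col_in_col_space[OF dims(1)] dims T_col A by auto
    have "scalar_prod v (col A j) - scalar_prod ?w (col A j) = 0"
      using orthogonal_basis_residual[OF sub B v col(1)] col(2) v
      by (simp add: minus_scalar_prod_distrib[of _ ?n])
    then have "scalar_prod (col A j) v = scalar_prod (col A j) ?w"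
      using comm_scalar_prod[OF col(2) v] comm_scalar_prod[OF col(2) orth_expansion_carrier[of ?n B v]]
      by simp
    then show "(A\<^sup>T *\<^sub>v v) $ j = (A\<^sup>T *\<^sub>v orth_proj T v) $ j"
      using j dims orth_proj_eq_orth_expansion[OF sub B v] by simp
  qed simp
  have "cond_indep_var M borel Y (borel_vec ?n) (\<lambda>\<omega>. vec_array ps (X \<omega>))
      (borel_vec ?n) (\<lambda>\<omega>. orth_proj T (vec_array ps (X \<omega>)))"
    by (rule cond_indep_var_transfer[OF indep[folded A_def d_def] measurable_vec_array g _
          measurable_mult_mat_vec[OF A']])
       (rule proj recover, simp)+
  then show ?thesis
    using sub unfolding dr_subspace_def by blast
qed

text \<open>The candidates of which \<open>kron_envelope\<close> is the least.\<close>
definition is_kron_cover :: "'w measure \<Rightarrow> nat list \<Rightarrow> ('w \<Rightarrow> real mat) \<Rightarrow> real vec set \<Rightarrow> bool" where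
  "is_kron_cover M ps U K \<longleftrightarrow>
     (\<exists>Ss. list_all2 vec_subspace ps Ss \<and> K = kron_space ps Ss \<and>
        (AE \<omega> in M. col_space (prod_list ps) (U \<omega>) \<subseteq> K))"

text \<open>
  The point is that the least candidate exists; by its definition the envelope then equals it.
\<close>
lemma kron_envelope_least:
  assumes T: "is_kron_cover M ps U T"
  shows "kron_envelope M ps U \<subseteq> T"
proof -
  let ?F = "{K. is_kron_cover M ps U K}"
  have sub: "vec_subspace (prod_list ps) K" if "K \<in> ?F" for K
    using that vec_subspace_kron_space unfolding is_kron_cover_def by blast
  have inter: "K \<inter> K' \<in> ?F" if K: "K \<in> ?F" and K': "K' \<in> ?F" for K K'
  proof -
    from K obtain Ss where Ss: "list_all2 vec_subspace ps Ss" "K = kron_space ps Ss"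
      and AE: "AE \<omega> in M. col_space (prod_list ps) (U \<omega>) \<subseteq> K"
      unfolding is_kron_cover_def by blast
    from K' obtain Ss' where Ss': "list_all2 vec_subspace ps Ss'" "K' = kron_space ps Ss'"
      and AE': "AE \<omega> in M. col_space (prod_list ps) (U \<omega>) \<subseteq> K'"
      unfolding is_kron_cover_def by blast
    have "AE \<omega> in M. col_space (prod_list ps) (U \<omega>) \<subseteq> K \<inter> K'"
      using AE AE' by eventually_elim blast
    then show ?thesis
      using kron_space_Int[OF Ss(1) Ss'(1)] Ss(2) Ss'(2) unfolding is_kron_cover_def by blast
  qed
  from T have "T \<in> ?F" by simp
  from least_of_inter_closed_subspaces[OF this sub inter]
  obtain K where K: "K \<in> ?F" "\<And>K'. K' \<in> ?F \<Longrightarrow> K \<subseteq> K'" by blast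
  have "kron_envelope M ps U = K"
    unfolding kron_envelope_def is_kron_cover_def[symmetric]
    using K by (intro Least_equality) auto
  then show ?thesis
    using K(2) T by simp
qed

theorem theorem5:
  fixes M :: "'w measure"
    and ps :: "nat list" and k :: nat
    and X :: "'w \<Rightarrow> nat list \<Rightarrow> real"
    and Y :: "'w \<Rightarrow> real"
    and U :: "'w \<Rightarrow> real mat"
  assumes "prob_space M"
    and "X \<in> measurable M (borel_array ps)"
    and "Y \<in> borel_measurable M"
    and "dr_subspace M Y (prod_list ps) (\<lambda>\<omega>. vec_array ps (X \<omega>))
           (central_subspace M Y (prod_list ps) (\<lambda>\<omega>. vec_array ps (X \<omega>)))"
    and "\<exists>T. folding_subspace M Y ps X T \<and> (\<forall>T'. folding_subspace M Y ps X T' \<longrightarrow> T \<subseteq> T')"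
    and "U \<in> measurable M (borel_mat (prod_list ps) k)"
    and "AE \<omega> in M. col_space (prod_list ps) (U \<omega>)
           \<subseteq> central_subspace M Y (prod_list ps) (\<lambda>\<omega>. vec_array ps (X \<omega>))"
  shows "kron_envelope M ps U \<subseteq> central_folding_subspace M Y ps X"
proof -
  from assms(5) obtain T where T: "folding_subspace M Y ps X T"
    and least: "\<And>T'. folding_subspace M Y ps X T' \<Longrightarrow> T \<subseteq> T'" by blast
  have cfs: "central_folding_subspace M Y ps X = T"
    unfolding central_folding_subspace_def using T least by (intro Least_equality)
  have "central_subspace M Y (prod_list ps) (\<lambda>\<omega>. vec_array ps (X \<omega>)) \<subseteq> T"
    unfolding central_subspace_def using folding_subspace_imp_dr_subspace[OF T] by blast
  with assms(7) have "AE \<omega> in M. col_space (prod_list ps) (U \<omega>) \<subseteq> T"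
    by (auto elim: eventually_mono)
  then have "is_kron_cover M ps U T"
    using folding_subspace_kron_space[OF T] unfolding is_kron_cover_def by blast
  then show ?thesis
    unfolding cfs by (rule kron_envelope_least)
qed

end
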